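(* Let $\mathcal{V}\subseteq\mathbb{R}^{n\times n}$ be a vector space, $F:\mathcal{V}\to\mathbb{R}$, and let $\boldsymbol{G}:\mathcal{V}\to\mathcal{V}$ be any matrix function defined by an analytic scalar function. Let $\boldsymbol{X},\boldsymbol{H}\in\mathcal{V}$ and assume $F$ is differentiable at $\boldsymbol{G}(\boldsymbol{X})$ and $\boldsymbol{G}$ is differentiable at $\boldsymbol{X}$. Then, assuming $F$ and $\boldsymbol{G}$ are two-times continuously differentiable, the first and second-order directional derivatives of $F\circ\boldsymbol{G}$ at $\boldsymbol{X}$ in the direction of $\boldsymbol{H}$ are $$D(F\circ\boldsymbol{G})(\boldsymbol{X})[\boldsymbol{H}]=DF(\boldsymbol{G}(\boldsymbol{X}))\big[D\boldsymbol{G}(\boldsymbol{X})[\boldsymbol{H}]\big],$$ $$D^2(F\circ\boldsymbol{G})(\boldsymbol{X})[\boldsymbol{H},\boldsymbol{H}]=D^2F(\boldsymbol{G}(\boldsymbol{X}))\big[D\boldsymbol{G}(\boldsymbol{X})[\boldsymbol{H}],D\boldsymbol{G}(\boldsymbol{X})[\boldsymbol{H}]\big]+DF(\boldsymbol{G}(\boldsymbol{X}))\big[D^2\boldsymbol{G}(\boldsymbol{X})[\boldsymbol{H},\boldsymbol{H}]\big].$$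
   Context: Matrix functions: for a scalar function $G:\mathbb{R}\to\mathbb{R}$ and a symmetric matrix $\boldsymbol{X}$ with spectral decomposition $\boldsymbol{X}=\boldsymbol{Q}\boldsymbol{\Lambda}\boldsymbol{Q}^\top$, the matrix function defined by $G$ is $\boldsymbol{G}(\boldsymbol{X})=\boldsymbol{Q}\operatorname{Diag}(G(\Lambda_{11}),\dots,G(\Lambda_{nn}))\boldsymbol{Q}^\top$; for general square $\boldsymbol{X}$ it is the usual (primary) matrix function of $G$, which agrees with $\sum_i a_i\boldsymbol{X}^i$ when $G$ is given by a power series $\sum_i a_ix^i$ converging on the spectrum of $\boldsymbol{X}$. It is assumed that $\boldsymbol{G}$ maps $\mathcal{V}$ into $\mathcal{V}$. Derivatives: $\langle\boldsymbol{A},\boldsymbol{B}\rangle=\operatorname{Tr}(\boldsymbol{A}^\top\boldsymbol{B})$. For real-valued $F$, $DF(\boldsymbol{X})[\boldsymbol{H}]=\frac{d}{dt}F(\boldsymbol{X}+t\boldsymbol{H})|_{t=0}=\langle\nabla F(\boldsymbol{X}),\boldsymbol{H}\rangle$ with gradient $\nabla F(\boldsymbol{X})\in\mathcal{V}$; the Hessian is $\nabla^2F(\boldsymbol{X})[\boldsymbol{H}]=\frac{d}{dt}\nabla F(\boldsymbol{X}+t\boldsymbol{H})|_{t=0}$ and $D^2F(\boldsymbol{X})[\boldsymbol{H}_1,\boldsymbol{H}_2]=\langle\nabla^2F(\boldsymbol{X})[\boldsymbol{H}_1],\boldsymbol{H}_2\rangle$. For the matrix-valued map $\boldsymbol{G}$,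 $D\boldsymbol{G}(\boldsymbol{X})[\boldsymbol{H}]=\frac{d}{dt}\boldsymbol{G}(\boldsymbol{X}+t\boldsymbol{H})|_{t=0}$ and $D^2\boldsymbol{G}(\boldsymbol{X})[\boldsymbol{H},\boldsymbol{H}]=\frac{d^2}{dt^2}\boldsymbol{G}(\boldsymbol{X}+t\boldsymbol{H})|_{t=0}$. *)

theory Defs
  imports "HOL-Analysis.Analysis" "HOL-Computational_Algebra.Polynomial"
begin

unbundle no fps_syntax

section \<open>Primary matrix functions\<close>

definition diag_mat :: "('n \<Rightarrow> 'a) \<Rightarrow> ('a::zero)^'n^'n" where
  "diag_mat d = (\<chi> i j. if i = j then d i else 0)"

definition eigenvalue :: "complex^'n^'n \<Rightarrow> complex \<Rightarrow> bool" where
  "eigenvalue A l \<longleftrightarrow> (\<exists>v. v \<noteq> 0 \<and> A *v v = l *s v)"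

text \<open>
  The index of an eigenvalue is its multiplicity as a root of the minimal polynomial, i.e. the
  size of its largest Jordan block: the least \<open>k\<close> at which the kernels of the powers
  \<open>(A - l I)^k\<close> stop growing.
\<close>

definition eigenvalue_index :: "complex^'n^'n \<Rightarrow> complex \<Rightarrow> nat" where
  "eigenvalue_index A l =
     (LEAST k. \<forall>v. (((*v) (A - mat l)) ^^ Suc k) v = 0 \<longrightarrow> (((*v) (A - mat l)) ^^ k) v = 0)"

text \<open>
  \<open>p(A)\<close> for a polynomial \<open>p\<close>, by Horner's scheme. (The product \<open>*\<close> and
  the power \<open>^\<close> of the library act entrywise on matrices.)
\<close>

definition poly_mat :: "('a::comm_ring_1) poly \<Rightarrow> 'a^'n^'n \<Rightarrow> 'a^'n^'n" where
  "poly_mat p A = fold_coeffs (\<lambda>a B. mat a + A ** B) p 0"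

text \<open>
  \<open>B = f(A)\<close> in the sense of the Hermite interpolation definition of a primary matrix
  function: \<open>B = p(A)\<close> for a polynomial \<open>p\<close> that agrees with \<open>f\<close> on the
  spectrum of \<open>A\<close>, including the derivatives of order below the index.
\<close>

definition primary_matrix_function ::
    "(complex \<Rightarrow> complex) \<Rightarrow> complex^'n^'n \<Rightarrow> complex^'n^'n \<Rightarrow> bool" where
  "primary_matrix_function f A B \<longleftrightarrow>
     (\<exists>p. (\<forall>l. eigenvalue A l \<longrightarrow>
              (\<forall>j < eigenvalue_index A l. poly ((pderiv ^^ j) p) l = (deriv ^^ j) f l)) \<and>
          B = poly_mat p A)"

definition real_analytic :: "(real \<Rightarrow> real) \<Rightarrow> bool" where
  "real_analytic g \<longleftrightarrow>
     (\<forall>x. \<exists>r>0. \<exists>a. \<forall>y. \<bar>y - x\<bar> < r \<longrightarrow> (\<lambda>k. a k * (y - x) ^ k) sums g y)"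

text \<open>
  \<open>G\<close> is the matrix function on \<open>V\<close> defined by the scalar function
  \<open>g\<close>. A real matrix may have non-real eigenvalues; there \<open>g\<close> is evaluated through its
  holomorphic continuation \<open>f\<close>, which is unique on the connected set \<open>U\<close> because
  \<open>U\<close> contains the real line.
\<close>

definition matrix_function_on ::
    "(real^'n^'n) set \<Rightarrow> (real \<Rightarrow> real) \<Rightarrow> (real^'n^'n \<Rightarrow> real^'n^'n) \<Rightarrow> bool" where
  "matrix_function_on V g G \<longleftrightarrow>
     (\<exists>U f. open U \<and> connected U \<and> \<real> \<subseteq> U \<and> f holomorphic_on U \<and>
        (\<forall>x. f (complex_of_real x) = complex_of_real (g x)) \<and>
        (\<forall>X\<in>V. (\<forall>l. eigenvalue (map_matrix complex_of_real X) l \<longrightarrow> l \<in> U) \<and>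
           primary_matrix_function f
             (map_matrix complex_of_real X) (map_matrix complex_of_real (G X))))"


section \<open>Derivatives on a subspace\<close>

text \<open>The inner product of the library on matrices is \<open>Tr (A\<^sup>T B)\<close>.\<close>

lemma inner_matrix_eq_trace: "A \<bullet> B = trace (transpose A ** B)" for A B :: "real^'n^'n"
  unfolding inner_vec_def trace_def matrix_matrix_mult_def transpose_def
  by (simp, subst sum.swap, simp)

definition dir_deriv ::
    "('a::real_normed_vector \<Rightarrow> 'b::real_normed_vector) \<Rightarrow> 'a \<Rightarrow> 'a \<Rightarrow> 'b" where
  "dir_deriv f X H = vector_derivative (\<lambda>t. f (X + t *\<^sub>R H)) (at 0)"

definition dir_deriv2 ::
    "('a::real_normed_vector \<Rightarrow> 'b::real_normed_vector) \<Rightarrow> 'a \<Rightarrow> 'a \<Rightarrow> 'b" where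
  "dir_deriv2 f X H =
     vector_derivative (\<lambda>s. vector_derivative (\<lambda>t. f (X + t *\<^sub>R H)) (at s)) (at 0)"

definition has_gradient_on ::
    "'a::real_inner set \<Rightarrow> ('a \<Rightarrow> real) \<Rightarrow> 'a \<Rightarrow> 'a \<Rightarrow> bool" where
  "has_gradient_on V F X D \<longleftrightarrow>
     D \<in> V \<and> (\<forall>H\<in>V. ((\<lambda>t. F (X + t *\<^sub>R H)) has_real_derivative D \<bullet> H) (at 0))"

definition gradient_on :: "'a::real_inner set \<Rightarrow> ('a \<Rightarrow> real) \<Rightarrow> 'a \<Rightarrow> 'a" where
  "gradient_on V F X = (THE D. has_gradient_on V F X D)"

definition hessian_on :: "'a::real_inner set \<Rightarrow> ('a \<Rightarrow> real) \<Rightarrow> 'a \<Rightarrow> 'a \<Rightarrow> 'a" where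
  "hessian_on V F X H = vector_derivative (\<lambda>t. gradient_on V F (X + t *\<^sub>R H)) (at 0)"

definition second_deriv_on ::
    "'a::real_inner set \<Rightarrow> ('a \<Rightarrow> real) \<Rightarrow> 'a \<Rightarrow> 'a \<Rightarrow> 'a \<Rightarrow> real" where
  "second_deriv_on V F X H1 H2 = hessian_on V F X H1 \<bullet> H2"

text \<open>
  Only the values of \<open>f\<close> on the subspace \<open>V\<close> matter below. The derivatives
  \<open>f'\<close> and \<open>f''\<close> are determined by \<open>f\<close> on directions in
  \<open>V\<close> only; a derivative on \<open>V\<close> extends continuously to the whole space by composition
  with the orthogonal projection.
\<close>

definition twice_continuously_differentiable_on ::
    "('a::real_normed_vector \<Rightarrow> 'b::real_normed_vector) \<Rightarrow> 'a set \<Rightarrow> bool" where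
  "twice_continuously_differentiable_on f V \<longleftrightarrow>
     (\<exists>(f' :: 'a \<Rightarrow> 'a \<Rightarrow>\<^sub>L 'b) (f'' :: 'a \<Rightarrow> 'a \<Rightarrow>\<^sub>L ('a \<Rightarrow>\<^sub>L 'b)).
        (\<forall>X\<in>V. (f has_derivative blinfun_apply (f' X)) (at X within V)) \<and>
        (\<forall>X\<in>V. (f' has_derivative blinfun_apply (f'' X)) (at X within V)) \<and>
        continuous_on V f'')"

lemma has_gradient_on_unique:
  assumes V: "subspace V" and D: "has_gradient_on V F X D" and E: "has_gradient_on V F X E"
  shows "D = E"
proof -
  have "D - E \<in> V"
    using assms by (simp add: has_gradient_on_def subspace_diff)
  then have "D \<bullet> (D - E) = E \<bullet> (D - E)"
    using D E unfolding has_gradient_on_def by (meson DERIV_unique)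
  then have "(D - E) \<bullet> (D - E) = 0"
    by (simp add: inner_diff_left)
  then show ?thesis by simp
qed

lemma gradient_on_eqI: "subspace V \<Longrightarrow> has_gradient_on V F X D \<Longrightarrow> gradient_on V F X = D"
  unfolding gradient_on_def by (blast intro: has_gradient_on_unique)


section \<open>Consistency of primary matrix functions with the spectral decomposition\<close>

lemma matrix_ring_distribs:
  fixes A B C :: "'a::comm_ring_1^'n^'n"
  shows "(A + B) ** C = A ** C + B ** C"
    and "A ** (B - C) = A ** B - A ** C"
    and "(A - B) ** C = A ** C - B ** C"
  by (simp_all add: matrix_matrix_mult_def vec_eq_iff algebra_simps sum.distrib sum_subtractf)

lemma poly_mat_0 [simp]: "poly_mat 0 A = 0"
  by (simp add: poly_mat_def)

lemma mat_0 [simp]: "mat 0 = 0"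
  by (simp add: mat_def vec_eq_iff)

lemma poly_mat_pCons [simp]: "poly_mat (pCons a p) A = mat a + A ** poly_mat p A"
proof (cases "p = 0 \<and> a = 0")
  case True
  then show ?thesis by (simp add: vec_eq_iff matrix_matrix_mult_def)
next
  case False
  then show ?thesis by (auto simp: poly_mat_def)
qed

lemma diag_mat_mult:
  fixes d e :: "'n::finite \<Rightarrow> 'a::comm_ring_1"
  shows "diag_mat d ** diag_mat e = diag_mat (\<lambda>i. d i * e i)"
proof -
  have "(\<Sum>k\<in>UNIV. (if i = k then d i else 0) * (if k = j then e k else 0))
      = (\<Sum>k\<in>UNIV. if k = i then (if i = j then d i * e i else 0) else 0)" for i j
    by (rule sum.cong) auto
  then show ?thesis
    by (simp add: diag_mat_def matrix_matrix_mult_def vec_eq_iff)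
qed

lemma mat_diag: "mat a = diag_mat (\<lambda>_. a)"
  by (simp add: mat_def diag_mat_def)

lemma diag_mat_vec:
  fixes v :: "'a::comm_ring_1^'n"
  shows "diag_mat d *v v = (\<chi> i. d i * v $ i)"
  by (simp add: diag_mat_def matrix_vector_mult_def vec_eq_iff if_distrib if_distribR cong: if_cong)

lemma conj_diag_mult:
  fixes P R :: "'a::comm_ring_1^'n^'n"
  assumes "R ** P = mat 1"
  shows "(P ** diag_mat d ** R) ** (P ** diag_mat e ** R) = P ** diag_mat (\<lambda>i. d i * e i) ** R"
proof -
  have "(P ** diag_mat d ** R) ** (P ** diag_mat e ** R)
      = P ** diag_mat d ** (R ** P) ** diag_mat e ** R"
    by (simp add: matrix_mul_assoc)
  also have "\<dots> = P ** (diag_mat d ** diag_mat e) ** R"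
    using assms by (simp add: matrix_mul_assoc)
  finally show ?thesis by (simp add: diag_mat_mult)
qed

lemma mat_conj_diag:
  fixes P R :: "'a::comm_ring_1^'n^'n"
  assumes "P ** R = mat 1"
  shows "P ** diag_mat (\<lambda>_. a) ** R = mat a"
proof -
  have "P ** mat a = mat a ** P"
    by (simp add: mat_def matrix_matrix_mult_def vec_eq_iff if_distrib if_distribR mult.commute
             cong: if_cong)
  then have "P ** mat a ** R = mat a ** (P ** R)"
    by (simp add: matrix_mul_assoc)
  then show ?thesis
    using assms by (simp add: mat_diag[symmetric])
qed

lemma poly_mat_conj_diag:
  fixes P R :: "'a::comm_ring_1^'n^'n"
  assumes "P ** R = mat 1" "R ** P = mat 1"
  shows "poly_mat p (P ** diag_mat d ** R) = P ** diag_mat (\<lambda>i. poly p (d i)) ** R"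
proof (induction p)
  case 0
  show ?case using mat_conj_diag[OF assms(1), of 0] by simp
next
  case (pCons a p)
  have "mat a + P ** diag_mat (\<lambda>i. d i * poly p (d i)) ** R
      = P ** (diag_mat (\<lambda>_. a) + diag_mat (\<lambda>i. d i * poly p (d i))) ** R"
    using mat_conj_diag[OF assms(1), of a] by (simp add: matrix_add_ldistrib matrix_ring_distribs)
  also have "diag_mat (\<lambda>_. a) + diag_mat (\<lambda>i. d i * poly p (d i))
      = diag_mat (\<lambda>i. poly (pCons a p) (d i))"
    by (simp add: diag_mat_def vec_eq_iff)
  finally show ?case
    using pCons.IH by (simp add: conj_diag_mult[OF assms(2)])
qed

lemma interpolating_poly_exists:
  fixes h :: "'a::field \<Rightarrow> 'a"
  assumes "finite S"
  shows "\<exists>p. \<forall>x\<in>S. poly p x = h x"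
  using assms
proof (induction S)
  case (insert y S)
  then obtain p where p: "\<forall>x\<in>S. poly p x = h x" by blast
  define w where "w = (\<Prod>x\<in>S. [:- x, 1:])"
  have w: "poly w y \<noteq> 0" "\<forall>x\<in>S. poly w x = 0"
    using insert.hyps by (auto simp: w_def poly_prod prod_zero_iff)
  have "\<forall>x\<in>insert y S. poly (p + smult ((h y - poly p y) / poly w y) w) x = h x"
    using p w by auto
  then show ?case by blast
qed simp

lemma primary_matrix_function_conj_diag:
  fixes P R :: "complex^'n^'n"
  assumes PR: "P ** R = mat 1" "R ** P = mat 1"
  shows "primary_matrix_function f (P ** diag_mat d ** R) (P ** diag_mat (\<lambda>i. f (d i)) ** R)"
proof -
  define A where "A = P ** diag_mat d ** R"
  have shift: "A - mat l = P ** diag_mat (\<lambda>i. d i - l) ** R" for l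
  proof -
    have "A - mat l = P ** (diag_mat d - diag_mat (\<lambda>_. l)) ** R"
      using mat_conj_diag[OF PR(1), of l]
      by (simp add: A_def matrix_ring_distribs)
    also have "diag_mat d - diag_mat (\<lambda>_. l) = diag_mat (\<lambda>i. d i - l)"
      unfolding diag_mat_def by (simp add: vec_eq_iff)
    finally show ?thesis .
  qed
  have ker: "(P ** diag_mat e ** R) *v v = 0 \<longleftrightarrow> (\<forall>i. e i = 0 \<or> (R *v v) $ i = 0)" for e v
  proof -
    have "P *v w = 0 \<longleftrightarrow> w = 0" for w
    proof
      assume "P *v w = 0"
      then have "R *v (P *v w) = 0" by simp
      then show "w = 0" by (simp add: matrix_vector_mul_assoc PR)
    qed simp
    then have "(P ** diag_mat e ** R) *v v = 0 \<longleftrightarrow> diag_mat e *v (R *v v) = 0"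
      by (metis matrix_vector_mul_assoc)
    moreover have "diag_mat e *v w = 0 \<longleftrightarrow> (\<forall>i. e i = 0 \<or> w $ i = 0)" for w
      unfolding diag_mat_vec by (simp add: vec_eq_iff)
    ultimately show ?thesis by blast
  qed
  have range: "l \<in> range d" if eig: "eigenvalue A l" for l
  proof -
    obtain v where v: "v \<noteq> 0" "A *v v = l *s v"
      using eig unfolding eigenvalue_def by blast
    have "mat l *v v = l *s v"
      unfolding mat_diag diag_mat_vec by (simp add: vec_eq_iff)
    then have "(A - mat l) *v v = 0"
      using v by (simp add: matrix_vector_mult_diff_rdistrib)
    then have "\<forall>i. d i - l = 0 \<or> (R *v v) $ i = 0"
      unfolding shift ker .
    moreover have "P *v (R *v v) = v"
      by (simp add: matrix_vector_mul_assoc PR)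
    then have "R *v v \<noteq> 0"
      using v(1) by auto
    then obtain i where "(R *v v) $ i \<noteq> 0"
      unfolding vec_eq_iff zero_index by blast
    ultimately have "d i = l"
      by (metis eq_iff_diff_eq_0)
    then show ?thesis by blast
  qed
  have idx: "eigenvalue_index A l \<le> 1" for l
    unfolding eigenvalue_index_def
  proof (rule Least_le, intro allI impI)
    fix v
    assume "((*v) (A - mat l) ^^ Suc 1) v = 0"
    then have "((A - mat l) ** (A - mat l)) *v v = 0"
      by (simp add: matrix_vector_mul_assoc)
    then have "(A - mat l) *v v = 0"
      unfolding shift conj_diag_mult[OF PR(2)] ker by simp
    then show "((*v) (A - mat l) ^^ 1) v = 0"
      by simp
  qed
  obtain p where p: "\<forall>x\<in>range d. poly p x = f x"
    using interpolating_poly_exists[of "range d" f] by auto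
  have "poly ((pderiv ^^ j) p) l = (deriv ^^ j) f l"
    if "eigenvalue A l" "j < eigenvalue_index A l" for l j
  proof -
    have "j = 0" using that(2) idx[of l] by linarith
    then show ?thesis using range[OF that(1)] p by auto
  qed
  moreover have "poly_mat p A = P ** diag_mat (\<lambda>i. f (d i)) ** R"
    using p by (simp add: A_def poly_mat_conj_diag[OF PR])
  ultimately show ?thesis
    unfolding primary_matrix_function_def A_def[symmetric] by (intro exI[of _ p] conjI allI impI) auto
qed

lemma map_matrix_of_real_mult:
  "map_matrix complex_of_real (A ** B) = map_matrix complex_of_real A ** map_matrix complex_of_real B"
  by (simp add: map_matrix_def matrix_matrix_mult_def vec_eq_iff)

proposition primary_matrix_function_symmetric:
  fixes Q :: "real^'n^'n"
  assumes Q: "orthogonal_matrix Q" and f: "\<And>x. f (complex_of_real x) = complex_of_real (g x)"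
  shows "primary_matrix_function f
           (map_matrix complex_of_real (Q ** diag_mat d ** transpose Q))
           (map_matrix complex_of_real (Q ** diag_mat (\<lambda>i. g (d i)) ** transpose Q))"
proof -
  let ?c = "map_matrix complex_of_real :: real^'n^'n \<Rightarrow> complex^'n^'n"
  have 1: "?c (mat 1) = mat 1" "?c (diag_mat e) = diag_mat (\<lambda>i. complex_of_real (e i))" for e
    by (auto simp: map_matrix_def mat_def diag_mat_def vec_eq_iff)
  have "?c Q ** ?c (transpose Q) = mat 1" "?c (transpose Q) ** ?c Q = mat 1"
    using Q 1 by (simp_all add: orthogonal_matrix_def flip: map_matrix_of_real_mult)
  from primary_matrix_function_conj_diag[OF this, of f "\<lambda>i. complex_of_real (d i)"]
  show ?thesis
    by (simp add: map_matrix_of_real_mult 1 f)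
qed

end

theory Submission
  imports Defs
begin

text \<open>
  The formulas are the chain rule of order two. Write \<open>F', F''\<close> and \<open>G', G''\<close> for the Frechet
  derivatives along \<open>V\<close>. The map \<open>F \<circ> G\<close> has the derivative
  \<open>\<Phi>(Y) = F'(G Y) \<circ> G'(Y)\<close> at every \<open>Y \<in> V\<close>, and since composition of bounded linear maps is
  bilinear, the derivative of \<open>\<Phi>\<close> at \<open>X\<close> in the direction \<open>H\<close> is
  \<open>F''(G X)(G'(X) H) \<circ> G'(X) + F'(G X) \<circ> (G''(X) H)\<close>. Evaluated at \<open>H\<close>, this is the right-hand
  side of the second formula.

  Two things remain, both caused by the restriction to a subspace. The Hessian is defined through
  the gradient, which must lie in \<open>V\<close>; a fixed bounded linear operator \<open>R\<close> that represents each
  functional on \<open>V\<close> by a vector of \<open>V\<close> (\<open>riesz_operator_on_subspace\<close>) gives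
  \<open>\<nabla>f(Y) = R (f'(Y))\<close>, so that the gradient is differentiated by differentiating \<open>f'\<close>
  (\<open>second_deriv_on_eq\<close>). Moreover, the derivatives \<open>f'(Y)\<close> and \<open>f''(Y)\<close> are meaningful only on
  directions in \<open>V\<close>, so the directions \<open>G'(X) H\<close> and \<open>G''(X) H H\<close> have to be in \<open>V\<close>; they are,
  as velocities of curves in \<open>V\<close> (\<open>vector_derivative_in_subspace\<close>).
\<close>

section \<open>Derivatives along lines in a subspace\<close>

lemma line_in_subspace:
  "subspace V \<Longrightarrow> X \<in> V \<Longrightarrow> H \<in> V \<Longrightarrow> X + t *\<^sub>R H \<in> V"
  by (simp add: subspace_add subspace_scale)

lemma has_vector_derivative_along_line:
  fixes f :: "'a::real_normed_vector \<Rightarrow> 'b::real_normed_vector"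
  assumes V: "subspace V" "X \<in> V" "H \<in> V"
    and f: "(f has_derivative f') (at (X + s *\<^sub>R H) within V)"
  shows "((\<lambda>t. f (X + t *\<^sub>R H)) has_vector_derivative f' H) (at s)"
proof -
  have line: "((\<lambda>t. X + t *\<^sub>R H) has_derivative (\<lambda>t. t *\<^sub>R H)) (at s)"
    by (auto intro!: derivative_eq_intros)
  have "(f has_derivative f') (at (X + s *\<^sub>R H) within range (\<lambda>t. X + t *\<^sub>R H))"
    using f by (rule has_derivative_subset) (auto simp: line_in_subspace V)
  from diff_chain_within[OF line this]
  have "((\<lambda>t. f (X + t *\<^sub>R H)) has_derivative (\<lambda>t. f' (t *\<^sub>R H))) (at s)"
    by (simp add: o_def)
  then show ?thesis
    using linear_scale[OF has_derivative_linear[OF f]] by (simp add: has_vector_derivative_def)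
qed

lemma dir_deriv_eq:
  assumes "subspace V" "X \<in> V" "H \<in> V" "(f has_derivative f') (at X within V)"
  shows "dir_deriv f X H = f' H"
  unfolding dir_deriv_def
  using has_vector_derivative_along_line[of V X H f f' 0] assms
  by (simp add: vector_derivative_at)

lemma dir_deriv2_eq:
  fixes f' :: "'a::real_normed_vector \<Rightarrow> 'a \<Rightarrow>\<^sub>L 'b::real_normed_vector"
  assumes V: "subspace V" "X \<in> V" "H \<in> V"
    and f: "\<And>Y. Y \<in> V \<Longrightarrow> (f has_derivative blinfun_apply (f' Y)) (at Y within V)"
    and f': "(f' has_derivative f'') (at X within V)"
  shows "((\<lambda>t. blinfun_apply (f' (X + t *\<^sub>R H)) H) has_vector_derivative f'' H H) (at 0)"
    and "dir_deriv2 f X H = f'' H H"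
proof -
  have "((\<lambda>Y. blinfun_apply (f' Y) H) has_derivative (\<lambda>K. f'' K H)) (at X within V)"
    using f' by (rule bounded_linear.has_derivative[OF blinfun.bounded_linear_left])
  then show *: "((\<lambda>t. blinfun_apply (f' (X + t *\<^sub>R H)) H) has_vector_derivative f'' H H) (at 0)"
    using has_vector_derivative_along_line[of V X H _ _ 0] V by fastforce
  have "vector_derivative (\<lambda>t. f (X + t *\<^sub>R H)) (at s) = f' (X + s *\<^sub>R H) H" for s
    by (intro vector_derivative_at has_vector_derivative_along_line[OF V] f line_in_subspace V)
  then show "dir_deriv2 f X H = f'' H H"
    unfolding dir_deriv2_def using * by (simp add: vector_derivative_at)
qed

text \<open>
  The component \<open>z\<close> of \<open>c'\<close> orthogonal to the subspace vanishes: \<open>z \<bullet> c t\<close> is constantly \<open>0\<close>, and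
  its derivative is \<open>z \<bullet> c' = z \<bullet> z\<close>.
\<close>

lemma vector_derivative_in_subspace:
  fixes c :: "real \<Rightarrow> 'a::euclidean_space"
  assumes V: "subspace V" and c: "\<And>t. c t \<in> V" and c': "(c has_vector_derivative c') (at s)"
  shows "c' \<in> V"
proof -
  obtain y z where yz: "y \<in> span V" "\<And>w. w \<in> span V \<Longrightarrow> orthogonal z w" "c' = y + z"
    using orthogonal_subspace_decomp_exists[of V c'] by metis
  have "((\<lambda>t. z \<bullet> c t) has_vector_derivative z \<bullet> c') (at s)"
    using bounded_linear_inner_right c' by (rule bounded_linear.has_vector_derivative)
  moreover have "z \<bullet> c t = 0" for t
    using yz(2) span_base[OF c] by (simp add: orthogonal_def)
  ultimately have "z \<bullet> c' = 0"
    using vector_derivative_unique_at[of "\<lambda>_. 0" _ s 0] by auto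
  then have "z \<bullet> z = 0"
    using yz by (simp add: orthogonal_def inner_add_right)
  then show ?thesis
    using yz V by (simp add: span_eq_iff[THEN iffD2])
qed

section \<open>Gradients and Hessians on a subspace\<close>

text \<open>
  The representing vector of \<open>L\<close> is \<open>\<Sum>b\<in>B. L b *\<^sub>R b\<close> for an orthonormal basis \<open>B\<close> of the
  subspace. The point is that it depends linearly on \<open>L\<close>: derivatives commute with \<open>R\<close>.
\<close>

lemma riesz_operator_on_subspace:
  fixes V :: "'a::euclidean_space set"
  assumes V: "subspace V"
  obtains R :: "('a \<Rightarrow>\<^sub>L real) \<Rightarrow> 'a"
  where "bounded_linear R" "\<And>L. R L \<in> V" "\<And>L H. H \<in> V \<Longrightarrow> R L \<bullet> H = blinfun_apply L H"
proof -
  obtain B where B: "B \<subseteq> V" "pairwise orthogonal B" "\<And>b. b \<in> B \<Longrightarrow> norm b = 1"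
      "independent B" "card B = dim V" "span B = V"
    using orthonormal_basis_subspace[OF V] by metis
  have fin: "finite B"
    using B(4) by (rule independent_imp_finite)
  define R where "R L = (\<Sum>b\<in>B. blinfun_apply L b *\<^sub>R b)" for L :: "'a \<Rightarrow>\<^sub>L real"
  show ?thesis
  proof
    show "bounded_linear R"
      unfolding R_def
      by (intro bounded_linear_sum bounded_linear_compose[OF bounded_linear_scaleR_left]
          blinfun.bounded_linear_left)
    show "R L \<in> V" for L
      unfolding R_def using B(1) by (auto intro!: subspace_sum[OF V] subspace_scale[OF V])
    show "R L \<bullet> H = L H" if "H \<in> V" for L H
    proof (rule span_induct[of H B "\<lambda>H. R L \<bullet> H = L H", simplified])
      show "H \<in> span B"
        using that B(6) by simp
      show "subspace {H. R L \<bullet> H = L H}"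
        by (auto simp: subspace_def inner_add_right blinfun.add_right blinfun.scaleR_right)
      fix b assume b: "b \<in> B"
      have "R L \<bullet> b = (\<Sum>a\<in>B. if a = b then L b else 0)"
        unfolding R_def inner_sum_left
        using B(2) B(3)[OF b] b
        by (intro sum.cong) (auto simp: pairwise_def orthogonal_def norm_eq_1)
      then show "R L \<bullet> b = L b"
        using fin b by simp
    qed
  qed
qed

text \<open>
  On \<open>V\<close> the gradient is \<open>R \<circ> f'\<close> for a fixed bounded linear \<open>R\<close>. Differentiating it along the
  line gives the Hessian \<open>R (f'' H)\<close>, and pairing with \<open>K \<in> V\<close> undoes \<open>R\<close>.
\<close>

lemma
  fixes V :: "'a::euclidean_space set" and f' :: "'a \<Rightarrow> 'a \<Rightarrow>\<^sub>L real"
  assumes V: "subspace V"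
    and f: "\<And>Y. Y \<in> V \<Longrightarrow> (f has_derivative blinfun_apply (f' Y)) (at Y within V)"
  shows has_gradient_on_gradient_on:
      "Y \<in> V \<Longrightarrow> has_gradient_on V f Y (gradient_on V f Y)"
    and gradient_on_differentiable_along_line:
      "\<lbrakk>X \<in> V; H \<in> V; (f' has_derivative f'') (at X within V)\<rbrakk> \<Longrightarrow>
        (\<lambda>t. gradient_on V f (X + t *\<^sub>R H)) differentiable (at 0)"
    and second_deriv_on_eq:
      "\<lbrakk>X \<in> V; H \<in> V; K \<in> V; (f' has_derivative f'') (at X within V)\<rbrakk> \<Longrightarrow>
        second_deriv_on V f X H K = f'' H K"
proof -
  obtain R :: "('a \<Rightarrow>\<^sub>L real) \<Rightarrow> 'a" where R: "bounded_linear R" "\<And>L. R L \<in> V"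
      "\<And>L H. H \<in> V \<Longrightarrow> R L \<bullet> H = blinfun_apply L H"
    using riesz_operator_on_subspace[OF V] by metis
  have grad: "has_gradient_on V f Y (R (f' Y))" if Y: "Y \<in> V" for Y
    unfolding has_gradient_on_def
    using has_vector_derivative_along_line[OF V Y, where s = 0 and f = f] f[OF Y] R(2,3)
    by (simp add: has_real_derivative_iff_has_vector_derivative)
  then have eq: "gradient_on V f Y = R (f' Y)" if "Y \<in> V" for Y
    using gradient_on_eqI[OF V] that by blast
  show "has_gradient_on V f Y (gradient_on V f Y)" if "Y \<in> V"
    using grad eq that by simp
  have path: "((\<lambda>t. gradient_on V f (X + t *\<^sub>R H)) has_vector_derivative R (f'' H)) (at 0)"
    if X: "X \<in> V" and H: "H \<in> V" and f': "(f' has_derivative f'') (at X within V)"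
    for X H f''
  proof -
    have "((\<lambda>Y. R (f' Y)) has_derivative (\<lambda>K. R (f'' K))) (at X within V)"
      using f' by (rule bounded_linear.has_derivative[OF R(1)])
    then show ?thesis
      using has_vector_derivative_along_line[OF V X H, where s = 0]
      by (fastforce simp: eq line_in_subspace V X H)
  qed
  show "(\<lambda>t. gradient_on V f (X + t *\<^sub>R H)) differentiable (at 0)"
    if "X \<in> V" "H \<in> V" "(f' has_derivative f'') (at X within V)"
    using path[OF that] by (rule differentiableI_vector)
  show "second_deriv_on V f X H K = f'' H K"
    if "X \<in> V" "H \<in> V" "K \<in> V" "(f' has_derivative f'') (at X within V)"
    using path[OF that(1,2,4)] R(3)[OF that(3)]
    by (simp add: second_deriv_on_def hessian_on_def vector_derivative_at)
qed

section \<open>The chain rule of order two\<close>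

text \<open>
  In the derivative of \<open>Y \<mapsto> F'(G Y) \<circ> G'(Y)\<close>, the outer factor is differentiated by the chain
  rule and the two contributions are combined by the product rule for the bilinear composition.
\<close>

lemma has_derivative_blinfun_chain:
  fixes F' :: "'b::real_normed_vector \<Rightarrow> 'b \<Rightarrow>\<^sub>L 'c::real_normed_vector"
    and G' :: "'a::real_normed_vector \<Rightarrow> 'a \<Rightarrow>\<^sub>L 'b"
  assumes GV: "G ` V \<subseteq> W"
    and G: "(G has_derivative blinfun_apply (G' X)) (at X within V)"
    and G': "(G' has_derivative G'') (at X within V)"
    and F': "(F' has_derivative F'') (at (G X) within W)"
  shows "((\<lambda>Y. F' (G Y) o\<^sub>L G' Y) has_derivative
      (\<lambda>K. (F' (G X) o\<^sub>L G'' K) + (F'' (G' X K) o\<^sub>L G' X))) (at X within V)"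
proof -
  have "((\<lambda>Y. F' (G Y)) has_derivative (\<lambda>K. F'' (G' X K))) (at X within V)"
    using diff_chain_within[OF G has_derivative_subset[OF F' GV]] by (simp add: o_def)
  then show ?thesis
    using G' by (rule bounded_bilinear.FDERIV[OF bounded_bilinear_blinfun_compose])
qed

theorem theorem4:
  fixes V :: "(real^'n^'n) set"
    and F :: "real^'n^'n \<Rightarrow> real"
    and G :: "real^'n^'n \<Rightarrow> real^'n^'n"
    and g :: "real \<Rightarrow> real"
    and X H :: "real^'n^'n"
  assumes "subspace V"
    and "real_analytic g"
    and "matrix_function_on V g G"
    and "G ` V \<subseteq> V"
    and "X \<in> V" and "H \<in> V"
    and "F differentiable (at (G X) within V)"
    and "G differentiable (at X within V)"
    and "twice_continuously_differentiable_on F V"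
    and "twice_continuously_differentiable_on G V"
  shows "(\<lambda>t. (F \<circ> G) (X + t *\<^sub>R H)) differentiable (at 0) \<and>
         dir_deriv (F \<circ> G) X H = dir_deriv F (G X) (dir_deriv G X H) \<and>
         (\<forall>Y\<in>V. has_gradient_on V (F \<circ> G) Y (gradient_on V (F \<circ> G) Y)) \<and>
         (\<lambda>t. gradient_on V (F \<circ> G) (X + t *\<^sub>R H)) differentiable (at 0) \<and>
         second_deriv_on V (F \<circ> G) X H H =
           second_deriv_on V F (G X) (dir_deriv G X H) (dir_deriv G X H) +
           dir_deriv F (G X) (dir_deriv2 G X H)"
proof -
  from assms obtain F' F'' G' G'' where 
    F: "\<And>Y. Y \<in> V \<Longrightarrow> (F has_derivative blinfun_apply (F' Y)) (at Y within V)"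
      "\<And>Y. Y \<in> V \<Longrightarrow> (F' has_derivative blinfun_apply (F'' Y)) (at Y within V)"
    and G: "\<And>Y. Y \<in> V \<Longrightarrow> (G has_derivative blinfun_apply (G' Y)) (at Y within V)"
      "\<And>Y. Y \<in> V \<Longrightarrow> (G' has_derivative blinfun_apply (G'' Y)) (at Y within V)"
    unfolding twice_continuously_differentiable_on_def by metis
  note V = assms(1) and GV = assms(4) and X = assms(5) and H = assms(6)
  have GX: "G X \<in> V" and K: "G' X H \<in> V" and L: "G'' X H H \<in> V"
  proof -
    have path: "G (X + t *\<^sub>R H) \<in> V" for t
      using GV line_in_subspace[OF V X H] by blast
    from path[of 0] show "G X \<in> V" by simp
    have deriv: "((\<lambda>t. G (X + t *\<^sub>R H)) has_vector_derivative G' (X + s *\<^sub>R H) H) (at s)" for s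
      by (intro has_vector_derivative_along_line[OF V X H] G line_in_subspace V X H)
    have velocity: "G' (X + s *\<^sub>R H) H \<in> V" for s
      using vector_derivative_in_subspace[OF V path deriv] .
    from velocity[of 0] show "G' X H \<in> V" by simp
    show "G'' X H H \<in> V"
      using vector_derivative_in_subspace[OF V velocity dir_deriv2_eq(1)[OF V X H G(1) G(2)[OF X]]] .
  qed
  define \<Phi> where "\<Phi> Y = F' (G Y) o\<^sub>L G' Y" for Y
  have \<Phi>: "((F \<circ> G) has_derivative \<Phi> Y) (at Y within V)" if Y: "Y \<in> V" for Y
  proof -
    have "(F has_derivative F' (G Y)) (at (G Y) within G ` V)"
      using F(1) GV Y by (blast intro: has_derivative_subset)
    from diff_chain_within[OF G(1)[OF Y] this] show ?thesis
      by (simp add: \<Phi>_def blinfun_compose.rep_eq o_def)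
  qed
  have \<Phi>': "(\<Phi> has_derivative
      (\<lambda>K. (F' (G X) o\<^sub>L G'' X K) + (F'' (G X) (G' X K) o\<^sub>L G' X))) (at X within V)"
    unfolding \<Phi>_def
    by (rule has_derivative_blinfun_chain[OF GV G(1)[OF X] G(2)[OF X] F(2)[OF GX]])
  have "(\<lambda>t. (F \<circ> G) (X + t *\<^sub>R H)) differentiable (at 0)"
    using has_vector_derivative_along_line[OF V X H, of "F \<circ> G" _ 0] \<Phi>[OF X]
    by (auto intro: differentiableI_vector)
  moreover have "dir_deriv (F \<circ> G) X H = dir_deriv F (G X) (dir_deriv G X H)"
    using K by (simp add: dir_deriv_eq[OF V X H \<Phi>] dir_deriv_eq[OF V X H G(1)]
        dir_deriv_eq[OF V GX _ F(1)] X GX \<Phi>_def)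
  moreover have "\<forall>Y\<in>V. has_gradient_on V (F \<circ> G) Y (gradient_on V (F \<circ> G) Y)"
    using has_gradient_on_gradient_on[OF V \<Phi>] by blast
  moreover have "(\<lambda>t. gradient_on V (F \<circ> G) (X + t *\<^sub>R H)) differentiable (at 0)"
    by (rule gradient_on_differentiable_along_line[OF V \<Phi> X H \<Phi>'])
  moreover have "second_deriv_on V (F \<circ> G) X H H =
      second_deriv_on V F (G X) (dir_deriv G X H) (dir_deriv G X H) +
      dir_deriv F (G X) (dir_deriv2 G X H)"
    using second_deriv_on_eq[OF V \<Phi> X H H \<Phi>'] second_deriv_on_eq[OF V F(1) GX K K F(2)[OF GX]]
      dir_deriv_eq[OF V X H G(1)[OF X]] dir_deriv2_eq(2)[OF V X H G(1) G(2)[OF X]]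
      dir_deriv_eq[OF V GX L F(1)[OF GX]]
    by (simp add: blinfun.add_left)
  ultimately show ?thesis by blast
qed

end
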